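(* Let $(M,g)$ be a smooth, complete, compact Riemannian manifold, let $q:M\to(1,\infty)$ be a measurable variable exponent, and let $q'$ be defined by $\frac1{q(x)}+\frac1{q'(x)}=1$. Then there is a positive constant $r_q$, depending on $q^-$ and $q^+$, such that for all $u\in L^{q(\cdot)}(M)$ and $v\in L^{q'(\cdot)}(M)$, $$\int_M|u(x)\,v(x)|\,dv_g(x)\le r_q\,\|u\|_{L^{q(\cdot)}(M)}\,\|v\|_{L^{q'(\cdot)}(M)} .$$
   Context: $dv_g$ is the Riemannian volume measure, $q^-=\operatorname{ess\,inf}_M q$, $q^+=\operatorname{ess\,sup}_M q$. For a variable exponent $r$, $L^{r(\cdot)}(M)$ is the space of measurable $u:M\to\mathbb R$ with $\int_M|u|^{r(x)}dv_g<\infty$, with the Luxemburg norm $\|u\|_{L^{r(\cdot)}(M)}=\inf\{\gamma>0:\int_M|u/\gamma|^{r(x)}dv_g\le1\}$. *)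

theory Defs
  imports "HOL-Analysis.Analysis" "HOL-Probability.Essential_Supremum"
begin

section \<open>Smooth manifolds\<close>

text \<open>Meant for open \<open>S\<close>; \<open>C\<^sup>k\<^sup>+\<^sup>1\<close> means differentiable with all directional derivatives
  of class \<open>C\<^sup>k\<close>.\<close>

fun Ck_on :: "nat \<Rightarrow> ('b::euclidean_space \<Rightarrow> 'c::real_normed_vector) \<Rightarrow> 'b set \<Rightarrow> bool" where
  "Ck_on 0 f S \<longleftrightarrow> continuous_on S f"
| "Ck_on (Suc k) f S \<longleftrightarrow>
     (\<forall>x\<in>S. f differentiable (at x)) \<and>
     (\<forall>v. Ck_on k (\<lambda>x. frechet_derivative f (at x) v) S)"

definition smooth_on :: "'b set \<Rightarrow> ('b::euclidean_space \<Rightarrow> 'c::real_normed_vector) \<Rightarrow> bool" where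
  "smooth_on S f \<longleftrightarrow> (\<forall>k. Ck_on k f S)"

text \<open>A chart is a domain together with a coordinate map; the values of the map outside the
  domain are irrelevant.\<close>

type_synonym ('a, 'n) chart = "'a set \<times> ('a \<Rightarrow> real ^ 'n)"

definition is_chart :: "'a topology \<Rightarrow> ('a, 'n::finite) chart \<Rightarrow> bool" where
  "is_chart X = (\<lambda>(U, \<phi>). openin X U \<and> open (\<phi> ` U) \<and>
     homeomorphic_map (subtopology X U) (top_of_set (\<phi> ` U)) \<phi>)"

text \<open>Meaningful on \<open>\<phi> ` (U \<inter> V)\<close> for charts \<open>(U, \<phi>)\<close> and \<open>(V, \<psi>)\<close>.\<close>

definition transition :: "('a, 'n::finite) chart \<Rightarrow> ('a, 'n) chart \<Rightarrow> real ^ 'n \<Rightarrow> real ^ 'n" where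
  "transition = (\<lambda>(U, \<phi>) (V, \<psi>). \<psi> \<circ> inv_into U \<phi>)"

definition smooth_manifold :: "'a topology \<Rightarrow> ('a, 'n::finite) chart set \<Rightarrow> bool" where
  "smooth_manifold X A \<longleftrightarrow>
     Hausdorff_space X \<and> second_countable X \<and>
     (\<forall>c\<in>A. is_chart X c) \<and> (\<Union>c\<in>A. fst c) = topspace X \<and>
     (\<forall>c\<in>A. \<forall>d\<in>A. smooth_on (snd c ` (fst c \<inter> fst d)) (transition c d))"


section \<open>Riemannian metrics\<close>

text \<open>A metric is given by its coordinate expressions: \<open>g c p\<close> is the inner product on
  \<open>T\<^sub>pM\<close>, where \<open>T\<^sub>pM\<close> is identified with \<open>\<real>\<^sup>n\<close> by means of the chart \<open>c\<close> around \<open>p\<close>. The last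
  condition is the transformation law of a covariant 2-tensor.\<close>

type_synonym ('a, 'n) metric_tensor =
  "('a, 'n) chart \<Rightarrow> 'a \<Rightarrow> real ^ 'n \<Rightarrow> real ^ 'n \<Rightarrow> real"

definition riemannian_metric ::
  "('a, 'n::finite) chart set \<Rightarrow> ('a, 'n) metric_tensor \<Rightarrow> bool" where
  "riemannian_metric A g \<longleftrightarrow>
     (\<forall>c\<in>A. \<forall>p\<in>fst c. bilinear (g c p) \<and> (\<forall>v w. g c p v w = g c p w v) \<and>
        (\<forall>v. v \<noteq> 0 \<longrightarrow> 0 < g c p v v)) \<and>
     (\<forall>c\<in>A. \<forall>v w. smooth_on (snd c ` fst c) (\<lambda>x. g c (inv_into (fst c) (snd c) x) v w)) \<and>
     (\<forall>c\<in>A. \<forall>d\<in>A. \<forall>p\<in>fst c \<inter> fst d. \<forall>v w.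
        let D = frechet_derivative (transition c d) (at (snd c p))
        in g c p v w = g d p (D v) (D w))"

definition riemannian_manifold ::
  "'a topology \<Rightarrow> ('a, 'n::finite) chart set \<Rightarrow> ('a, 'n) metric_tensor \<Rightarrow> bool" where
  "riemannian_manifold X A g \<longleftrightarrow> smooth_manifold X A \<and> riemannian_metric A g"


section \<open>Riemannian distance and completeness\<close>

definition piecewise_C1_curve ::
  "'a topology \<Rightarrow> ('a, 'n::finite) chart set \<Rightarrow> (real \<Rightarrow> 'a) \<Rightarrow> bool" where
  "piecewise_C1_curve X A \<gamma> \<longleftrightarrow>
     continuous_map (top_of_set {0..1}) X \<gamma> \<and>
     (\<forall>c\<in>A. \<forall>a b. 0 \<le> a \<longrightarrow> a \<le> b \<longrightarrow> b \<le> 1 \<longrightarrow> \<gamma> ` {a..b} \<subseteq> fst c \<longrightarrow>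
        (snd c \<circ> \<gamma>) piecewise_C1_differentiable_on {a..b})"

text \<open>By the transformation law of \<open>g\<close>, the speed does not depend on the chosen chart wherever
  the curve is differentiable.\<close>

definition speed ::
  "('a, 'n::finite) chart set \<Rightarrow> ('a, 'n) metric_tensor \<Rightarrow> (real \<Rightarrow> 'a) \<Rightarrow> real \<Rightarrow> real" where
  "speed A g \<gamma> t =
     (let c = (SOME c. c \<in> A \<and> \<gamma> t \<in> fst c); w = vector_derivative (snd c \<circ> \<gamma>) (at t)
      in sqrt (g c (\<gamma> t) w w))"

definition curve_length ::
  "('a, 'n::finite) chart set \<Rightarrow> ('a, 'n) metric_tensor \<Rightarrow> (real \<Rightarrow> 'a) \<Rightarrow> ennreal" where
  "curve_length A g \<gamma> = (\<integral>\<^sup>+ t\<in>{0..1}. ennreal (speed A g \<gamma> t) \<partial>lborel)"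

text \<open>Infinite for points in different components.\<close>

definition riemannian_dist ::
  "'a topology \<Rightarrow> ('a, 'n::finite) chart set \<Rightarrow> ('a, 'n) metric_tensor \<Rightarrow> 'a \<Rightarrow> 'a \<Rightarrow> ennreal" where
  "riemannian_dist X A g p q =
     (INF \<gamma>\<in>{\<gamma>. piecewise_C1_curve X A \<gamma> \<and> \<gamma> 0 = p \<and> \<gamma> 1 = q}. curve_length A g \<gamma>)"

definition riemannian_complete ::
  "'a topology \<Rightarrow> ('a, 'n::finite) chart set \<Rightarrow> ('a, 'n) metric_tensor \<Rightarrow> bool" where
  "riemannian_complete X A g \<longleftrightarrow>
     (\<forall>s :: nat \<Rightarrow> 'a. range s \<subseteq> topspace X \<longrightarrow>
        (\<forall>e>0. \<exists>N. \<forall>m\<ge>N. \<forall>n\<ge>N. riemannian_dist X A g (s m) (s n) < e) \<longrightarrow>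
        (\<exists>p\<in>topspace X. (\<lambda>n. riemannian_dist X A g (s n) p) \<longlonglongrightarrow> 0))"


section \<open>The Riemannian volume measure\<close>

definition volume_density ::
  "('a, 'n::finite) metric_tensor \<Rightarrow> ('a, 'n) chart \<Rightarrow> 'a \<Rightarrow> real" where
  "volume_density g c p = sqrt (det (\<chi> i j. g c p (axis i 1) (axis j 1)))"

text \<open>The Borel measure on \<open>X\<close>, concentrated on the domain of the chart, that is given there by
  \<open>\<surd>(det g\<^sub>i\<^sub>j) dx\<close>.\<close>

definition chart_volume ::
  "'a topology \<Rightarrow> ('a, 'n::finite) metric_tensor \<Rightarrow> ('a, 'n) chart \<Rightarrow> 'a measure" where
  "chart_volume X g c =
     (let param = inv_into (fst c) (snd c) in
      distr (density (restrict_space lborel (snd c ` fst c)) (\<lambda>x. ennreal (volume_density g c (param x))))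
        (sigma (topspace X) {U. openin X U}) param)"

text \<open>By the change of variables formula the chart volumes agree on overlaps, so they are the
  restrictions to the chart domains of one Borel measure on \<open>X\<close>. Since countably many chart domains
  cover \<open>X\<close>, this measure is the least measure that dominates every chart volume, that is,
  their supremum in the lattice of measures. The completion makes \<open>measurable\<close> mean Lebesgue
  measurable in charts.\<close>

definition riemannian_volume ::
  "'a topology \<Rightarrow> ('a, 'n::finite) chart set \<Rightarrow> ('a, 'n) metric_tensor \<Rightarrow> 'a measure" where
  "riemannian_volume X A g = completion (SUP c\<in>A. chart_volume X g c)"


section \<open>Variable exponent Lebesgue spaces\<close>

definition essinf :: "'a measure \<Rightarrow> ('a \<Rightarrow> ereal) \<Rightarrow> ereal" where
  "essinf M f = - esssup M (\<lambda>x. - f x)"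

definition modular :: "'a measure \<Rightarrow> ('a \<Rightarrow> real) \<Rightarrow> ('a \<Rightarrow> real) \<Rightarrow> ennreal" where
  "modular M r u = (\<integral>\<^sup>+ x. ennreal (\<bar>u x\<bar> powr r x) \<partial>M)"

definition Lvar :: "'a measure \<Rightarrow> ('a \<Rightarrow> real) \<Rightarrow> ('a \<Rightarrow> real) set" where
  "Lvar M r = {u \<in> borel_measurable M. modular M r u < \<infinity>}"

definition luxemburg_norm :: "'a measure \<Rightarrow> ('a \<Rightarrow> real) \<Rightarrow> ('a \<Rightarrow> real) \<Rightarrow> real" where
  "luxemburg_norm M r u = Inf {\<gamma>. 0 < \<gamma> \<and> modular M r (\<lambda>x. u x / \<gamma>) \<le> 1}"

end

theory Submission
  imports Defs
begin

text \<open>The constant \<open>2\<close> works for all exponents. If \<open>\<gamma>\<close> and \<open>\<delta>\<close> are admissible in the infima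
  that define the two Luxemburg norms, Young's inequality, applied pointwise to \<open>u / \<gamma>\<close> and
  \<open>v / \<delta>\<close>, bounds \<open>\<integral>|u v|\<close> by \<open>\<gamma> \<delta>\<close> times the sum of two modulars, each at most \<open>1\<close>
  (\<open>nn_integral_mult_le_modular\<close>). Then \<open>\<gamma>\<close> and \<open>\<delta>\<close> tend to the norms. The real infimum in a norm
  is the greatest lower bound only over a nonempty set, so a function of finite modular must have
  an admissible \<open>\<gamma>\<close>. It does because the exponents are at least \<open>1\<close>: division by \<open>\<gamma> \<ge> 1\<close> shrinks
  the modular by at least the factor \<open>\<gamma>\<close> (\<open>modular_divide_le\<close>), even when \<open>q\<close> is essentially
  unbounded.

  This is carried out on an arbitrary measure space (\<open>Hoelder_variable_exponent\<close>) and applied to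
  the volume measure, which lives on the points of the manifold, where the two exponents are
  conjugate (\<open>space_riemannian_volume_subset\<close>).\<close>

lemma modular_divide_le:
  assumes u: "u \<in> borel_measurable M" and q: "q \<in> borel_measurable M"
    and q1: "\<And>x. x \<in> space M \<Longrightarrow> 1 \<le> q x" and c: "1 \<le> c"
  shows "modular M q (\<lambda>x. u x / c) \<le> ennreal (1 / c) * modular M q u"
proof -
  have [measurable]: "u \<in> borel_measurable M" "q \<in> borel_measurable M"
    by (fact u q)+
  have "modular M q (\<lambda>x. u x / c)
      \<le> (\<integral>\<^sup>+ x. ennreal (1 / c) * ennreal (\<bar>u x\<bar> powr q x) \<partial>M)"
    unfolding modular_def
  proof (rule nn_integral_mono)
    fix x assume x: "x \<in> space M"
    have "c \<le> c powr q x"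
      using powr_mono[OF q1[OF x] c] c by simp
    then have "\<bar>u x\<bar> powr q x / c powr q x \<le> \<bar>u x\<bar> powr q x / c"
      using c by (intro divide_left_mono) auto
    then have "\<bar>u x / c\<bar> powr q x \<le> 1 / c * \<bar>u x\<bar> powr q x"
      using c by (simp add: abs_divide powr_divide)
    then show "ennreal (\<bar>u x / c\<bar> powr q x) \<le> ennreal (1 / c) * ennreal (\<bar>u x\<bar> powr q x)"
      using c by (simp flip: ennreal_mult)
  qed
  also have "\<dots> = ennreal (1 / c) * modular M q u"
    unfolding modular_def by (rule nn_integral_cmult) measurable
  finally show ?thesis .
qed

lemma ex_modular_divide_le_1:
  assumes u: "u \<in> Lvar M q" and q: "q \<in> borel_measurable M"
    and q1: "\<And>x. x \<in> space M \<Longrightarrow> 1 \<le> q x"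
  shows "\<exists>\<gamma>>0. modular M q (\<lambda>x. u x / \<gamma>) \<le> 1"
proof -
  from u have meas: "u \<in> borel_measurable M" and fin: "modular M q u < \<infinity>"
    by (auto simp: Lvar_def)
  obtain m where m: "0 \<le> m" "modular M q u = ennreal m"
    using fin by (cases "modular M q u") auto
  let ?c = "max 1 m"
  have "modular M q (\<lambda>x. u x / ?c) \<le> ennreal (1 / ?c) * ennreal m"
    using modular_divide_le[OF meas q q1, of ?c] m by simp
  also have "\<dots> = ennreal (1 / ?c * m)"
    using m by (intro ennreal_mult[symmetric]) auto
  also have "\<dots> \<le> 1"
    using m by (auto simp: divide_le_eq max_def)
  finally show ?thesis
    by (intro exI[of _ ?c]) auto
qed

lemma nn_integral_mult_le_modular:
  assumes meas: "u \<in> borel_measurable M" "v \<in> borel_measurable M"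
      "q \<in> borel_measurable M" "q' \<in> borel_measurable M"
    and q1: "\<And>x. x \<in> space M \<Longrightarrow> 1 < q x" "\<And>x. x \<in> space M \<Longrightarrow> 1 < q' x"
    and conj: "\<And>x. x \<in> space M \<Longrightarrow> 1 / q x + 1 / q' x = 1"
    and \<gamma>: "0 < \<gamma>" "modular M q (\<lambda>x. u x / \<gamma>) \<le> 1"
    and \<delta>: "0 < \<delta>" "modular M q' (\<lambda>x. v x / \<delta>) \<le> 1"
  shows "(\<integral>\<^sup>+ x. ennreal \<bar>u x * v x\<bar> \<partial>M) \<le> ennreal (2 * \<gamma> * \<delta>)"
proof -
  note [measurable] = meas
  let ?U = "\<lambda>x. \<bar>u x / \<gamma>\<bar> powr q x" and ?V = "\<lambda>x. \<bar>v x / \<delta>\<bar> powr q' x"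
  have "(\<integral>\<^sup>+ x. ennreal \<bar>u x * v x\<bar> \<partial>M)
      \<le> (\<integral>\<^sup>+ x. ennreal (\<gamma> * \<delta>) * (ennreal (?U x) + ennreal (?V x)) \<partial>M)"
  proof (rule nn_integral_mono)
    fix x assume x: "x \<in> space M"
    have "\<bar>u x / \<gamma>\<bar> * \<bar>v x / \<delta>\<bar> \<le> ?U x / q x + ?V x / q' x"
      by (rule Youngs_inequality) (use x q1 conj in auto)
    \<comment> \<open>The weights \<open>1 / q\<close> and \<open>1 / q'\<close> are replaced by \<open>1\<close>; this makes the constant independent
      of the exponents and costs only the factor \<open>2\<close>.\<close>
    also have "\<dots> \<le> ?U x / 1 + ?V x / 1"
      using q1[OF x] by (intro add_mono divide_left_mono) auto
    finally have "(\<gamma> * \<delta>) * (\<bar>u x / \<gamma>\<bar> * \<bar>v x / \<delta>\<bar>) \<le> (\<gamma> * \<delta>) * (?U x + ?V x)"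
      using \<gamma>(1) \<delta>(1) by (intro mult_left_mono) auto
    moreover have "(\<gamma> * \<delta>) * (\<bar>u x / \<gamma>\<bar> * \<bar>v x / \<delta>\<bar>) = \<bar>u x * v x\<bar>"
      using \<gamma>(1) \<delta>(1) by (simp add: abs_mult abs_divide)
    ultimately have "ennreal \<bar>u x * v x\<bar> \<le> ennreal ((\<gamma> * \<delta>) * (?U x + ?V x))"
      by (simp only: ennreal_leI)
    then show "ennreal \<bar>u x * v x\<bar> \<le> ennreal (\<gamma> * \<delta>) * (ennreal (?U x) + ennreal (?V x))"
      using \<gamma>(1) \<delta>(1) by (simp add: ennreal_mult)
  qed
  also have "\<dots> = ennreal (\<gamma> * \<delta>) * (modular M q (\<lambda>x. u x / \<gamma>) + modular M q' (\<lambda>x. v x / \<delta>))"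
    unfolding modular_def by (simp add: nn_integral_cmult nn_integral_add)
  also have "\<dots> \<le> ennreal (\<gamma> * \<delta>) * (1 + 1)"
    by (intro mult_left_mono add_mono \<gamma> \<delta>) auto
  also have "\<dots> = ennreal (\<gamma> * \<delta> * 2)"
    using \<gamma>(1) \<delta>(1) by (subst ennreal_mult) auto
  finally show ?thesis
    by (simp add: mult_ac)
qed

text \<open>A bound by every product of elements passes to the product of the infima one factor at a
  time. The case of a vanishing infimum is separate, since the second step divides by it.\<close>

lemma le_mult_Inf_Inf:
  fixes S T :: "real set"
  assumes S: "S \<noteq> {}" "\<And>s. s \<in> S \<Longrightarrow> 0 < s" and T: "T \<noteq> {}" "\<And>t. t \<in> T \<Longrightarrow> 0 < t"
    and le: "\<And>s t. s \<in> S \<Longrightarrow> t \<in> T \<Longrightarrow> i \<le> s * t"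
  shows "i \<le> Inf S * Inf T"
proof -
  have nonneg: "0 \<le> Inf S"
    by (rule cInf_greatest[OF S(1)]) (use S(2) in \<open>auto intro: less_imp_le\<close>)
  have step: "i \<le> Inf S * t" if t: "t \<in> T" for t
  proof -
    have "i / t \<le> Inf S"
      by (rule cInf_greatest[OF S(1)]) (use le[OF _ t] T(2)[OF t] in \<open>simp add: divide_le_eq\<close>)
    then show ?thesis
      using T(2)[OF t] by (simp add: divide_le_eq)
  qed
  show ?thesis
  proof (cases "Inf S = 0")
    case True
    then show ?thesis
      using step T(1) by auto
  next
    case False
    with nonneg have pos: "0 < Inf S"
      by simp
    have "i / Inf S \<le> Inf T"
      by (rule cInf_greatest[OF T(1)]) (use step pos in \<open>simp add: divide_le_eq mult.commute\<close>)
    with pos show ?thesis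
      by (simp add: divide_le_eq mult.commute)
  qed
qed

theorem Hoelder_variable_exponent:
  assumes q: "q \<in> borel_measurable M"
    and q1: "\<And>x. x \<in> space M \<Longrightarrow> 1 < q x"
    and conj: "\<And>x. x \<in> space M \<Longrightarrow> 1 / q x + 1 / q' x = 1"
    and u: "u \<in> Lvar M q" and v: "v \<in> Lvar M q'"
  shows "(\<integral>\<^sup>+ x. ennreal \<bar>u x * v x\<bar> \<partial>M)
    \<le> ennreal (2 * luxemburg_norm M q u * luxemburg_norm M q' v)"
proof -
  have q'_eq: "q' x = 1 / (1 - 1 / q x)" if "x \<in> space M" for x
  proof -
    have "1 / q' x = 1 - 1 / q x"
      using conj[OF that] by simp
    then show ?thesis
      by (metis inverse_eq_divide inverse_inverse_eq)
  qed
  have q'1: "1 < q' x" if "x \<in> space M" for x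
    unfolding q'_eq[OF that] using q1[OF that] by (simp add: field_simps)
  have q': "q' \<in> borel_measurable M"
  proof (subst measurable_cong[OF q'_eq])
    show "(\<lambda>x. 1 / (1 - 1 / q x)) \<in> borel_measurable M"
      using q by measurable
  qed
  define S where "S = {\<gamma>. 0 < \<gamma> \<and> modular M q (\<lambda>x. u x / \<gamma>) \<le> 1}"
  define T where "T = {\<delta>. 0 < \<delta> \<and> modular M q' (\<lambda>x. v x / \<delta>) \<le> 1}"
  have S: "S \<noteq> {}"
    using ex_modular_divide_le_1[OF u q] q1 by (auto simp: S_def less_imp_le)
  have T: "T \<noteq> {}"
    using ex_modular_divide_le_1[OF v q'] q'1 by (auto simp: T_def less_imp_le)
  have bound: "(\<integral>\<^sup>+ x. ennreal \<bar>u x * v x\<bar> \<partial>M) \<le> ennreal (2 * \<gamma> * \<delta>)"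
    if "\<gamma> \<in> S" "\<delta> \<in> T" for \<gamma> \<delta>
    by (rule nn_integral_mult_le_modular[of u M v q q'])
       (use that u v q q' q1 q'1 conj in \<open>auto simp: S_def T_def Lvar_def\<close>)
  obtain \<gamma>0 \<delta>0 where "\<gamma>0 \<in> S" "\<delta>0 \<in> T"
    using S T by auto
  then obtain i where i: "0 \<le> i" "(\<integral>\<^sup>+ x. ennreal \<bar>u x * v x\<bar> \<partial>M) = ennreal i"
    using bound[of \<gamma>0 \<delta>0]
    by (cases "\<integral>\<^sup>+ x. ennreal \<bar>u x * v x\<bar> \<partial>M") (auto simp: top_unique)
  have "i / 2 \<le> Inf S * Inf T"
  proof (rule le_mult_Inf_Inf[OF S _ T])
    fix \<gamma> \<delta> assume *: "\<gamma> \<in> S" "\<delta> \<in> T"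
    then have "0 \<le> 2 * \<gamma> * \<delta>"
      by (simp add: S_def T_def)
    then show "i / 2 \<le> \<gamma> * \<delta>"
      using bound[OF *] i by (simp add: ennreal_le_iff)
  qed (auto simp: S_def T_def)
  then show ?thesis
    unfolding i(2) luxemburg_norm_def S_def T_def by (intro ennreal_leI) simp
qed

lemma space_riemannian_volume_subset: "space (riemannian_volume X A g) \<subseteq> topspace X"
proof -
  have "space (chart_volume X g c) = topspace X" for c
    unfolding chart_volume_def Let_def
    by (simp add: space_measure_of_conv)
  then show ?thesis
    by (auto simp: riemannian_volume_def space_Sup_eq_UN)
qed

theorem proposition2p3:
  shows "\<exists>r :: ereal \<Rightarrow> ereal \<Rightarrow> real. (\<forall>a b. 0 < r a b) \<and>
    (\<forall>(X :: 'a topology) (A :: ('a, 'n::finite) chart set) (g :: ('a, 'n) metric_tensor)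
       (q :: 'a \<Rightarrow> real) (q' :: 'a \<Rightarrow> real).
      riemannian_manifold X A g \<longrightarrow> riemannian_complete X A g \<longrightarrow> compact_space X \<longrightarrow>
      q \<in> borel_measurable (riemannian_volume X A g) \<longrightarrow>
      (\<forall>x\<in>topspace X. 1 < q x) \<longrightarrow>
      (\<forall>x\<in>topspace X. 1 / q x + 1 / q' x = 1) \<longrightarrow>
      (\<forall>u \<in> Lvar (riemannian_volume X A g) q. \<forall>v \<in> Lvar (riemannian_volume X A g) q'.
        (\<integral>\<^sup>+ x. ennreal \<bar>u x * v x\<bar> \<partial>riemannian_volume X A g)
        \<le> ennreal (r (essinf (riemannian_volume X A g) (\<lambda>x. ereal (q x)))
                     (esssup (riemannian_volume X A g) (\<lambda>x. ereal (q x)))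
                   * luxemburg_norm (riemannian_volume X A g) q u
                   * luxemburg_norm (riemannian_volume X A g) q' v)))"
proof (rule exI[of _ "\<lambda>_ _. 2"], intro conjI allI impI ballI)
  fix X :: "'a topology" and A :: "('a, 'n) chart set" and g :: "('a, 'n) metric_tensor"
    and q q' u v :: "'a \<Rightarrow> real"
  let ?M = "riemannian_volume X A g"
  assume q: "q \<in> borel_measurable ?M" "\<forall>x\<in>topspace X. 1 < q x"
    and q': "\<forall>x\<in>topspace X. 1 / q x + 1 / q' x = 1"
    and uv: "u \<in> Lvar ?M q" "v \<in> Lvar ?M q'"
  show "(\<integral>\<^sup>+ x. ennreal \<bar>u x * v x\<bar> \<partial>?M)
      \<le> ennreal (2 * luxemburg_norm ?M q u * luxemburg_norm ?M q' v)"
    by (rule Hoelder_variable_exponent)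
       (use q q' uv space_riemannian_volume_subset[of X A g] in auto)
qed simp

end
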